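(* Let $n,m\ge 1$, let $g_1,\ldots,g_m$ be computable functions from $\mathbb{Z}^{n+1}$ to $\mathbb{Z}^n$, and let $PROG=(S,I,R)$ be the while-loop program with vector of variables $\vec x=(x[1],\ldots,x[n])$ determined by $g_1,\ldots,g_m$. Let $f_1(\vec x),\ldots,f_M(\vec x)$ be functions from $\mathbb{Z}^n$ to $\mathbb{N}$, and let $C_1,\ldots,C_m$ be the $M\times M$ matrices, with entries in $\mathbb{Z}\cup\{\infty\}$, associated to $f_1,\ldots,f_M$ and the cases $\mathrm{control}=1,\ldots,\mathrm{control}=m$. If every (finite, nonempty, repetitions allowed) product of the matrices $C_1,\ldots,C_m$ has a negative number on the diagonal, then the program terminates, i.e., every computation of $PROG$ is finite.
   Context: $\mathbb{N}=\{0,1,2,\ldots\}$. The while-loop program determined by $g_1,\ldots,g_m:\mathbb{Z}^{n+1}\to\mathbb{Z}^n$ is the following. The state is $X=(x[1],\ldots,x[n])\in\mathbb{Z}^n$; initially $X$ is an arbitrary element of $\mathbb{Z}^n$ supplied by the user. While $x[1]>0$ and $x[2]>0$ and $\cdots$ and $x[n]>0$, the user chooses $\mathrm{control}=i\in\{1,\ldots,m\}$ and an integer $u\in\mathbb{Z}$, and $X$ is replaced by $g_i(X,u)$. Formally $S=I=\mathbb{Z}^n$, and $R(s,t)$ holds iff all coordinates of $s$ are positive and there exist $i\in\{1,\ldots,m\}$ and $u\in\mathbb{Z}$ with $t=g_i(s,u)$. A computation is a finite or infinite sequence of states $s_1,s_2,\ldots$ with $s_1\in I$, with $R(s_i,s_{i+1})$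 for all consecutive terms, and such that if the sequence is finite with last state $s$ then there is no $t$ with $R(s,t)$. The matrix $C_\ell$ associated to $f_1,\ldots,f_M$ and $\mathrm{control}=\ell$ records what is known about one execution of that case: its $(i,j)$ entry is the difference (new value of $f_j(\vec x)$) minus (old value of $f_i(\vec x)$) if this difference is known, and $\infty$ if it is not known. That is, each entry $C_\ell[i,j]$ is either $\infty$, or an integer $d$ such that for every state $X$ satisfying the loop condition and every $u\in\mathbb{Z}$, $f_j(g_\ell(X,u))=f_i(X)+d$. The product of two $M\times M$ matrices $A=(a_{ij})$, $B=(b_{ij})$ over $\mathbb{Z}\cup\{\infty\}$ is the nonstandard (min-plus) product $AB[i,j]=\min_{1\le k\le M}\{a_{ik}+b_{kj}\}$, where $\infty+x=x+\infty=\infty$ for all $x\in\mathbb{Z}\cup\{\infty\}$. *)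

theory Defs
  imports Main "HOL-Library.FuncSet" "HOL-Library.Nat_Bijection" "HOL-Library.Extended"
begin

section \<open>Computable functions on integer vectors\<close>

datatype recf = Zero | Succ | Proj nat | Comp recf "recf list" | PrimRec recf recf | Minim recf

text \<open>
  Graph semantics of the partial recursive functions: \<open>rec_eval r xs y\<close> means that \<open>r\<close>, applied to
  the argument tuple \<open>xs\<close>, is defined with value \<open>y\<close>. In primitive recursion and minimization the
  recursion variable, respectively the search variable, is the first argument.
\<close>

inductive rec_eval :: "recf \<Rightarrow> nat list \<Rightarrow> nat \<Rightarrow> bool" where
  "rec_eval Zero xs 0"
| "rec_eval Succ [x] (Suc x)"
| "i < length xs \<Longrightarrow> rec_eval (Proj i) xs (xs ! i)"
| "list_all2 (\<lambda>h y. rec_eval h xs y) hs ys \<Longrightarrow> rec_eval r ys z \<Longrightarrow> rec_eval (Comp r hs) xs z"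
| "rec_eval r xs y \<Longrightarrow> rec_eval (PrimRec r h) (0 # xs) y"
| "rec_eval (PrimRec r h) (k # xs) y \<Longrightarrow> rec_eval h (k # y # xs) z \<Longrightarrow>
     rec_eval (PrimRec r h) (Suc k # xs) z"
| "rec_eval r (k # xs) 0 \<Longrightarrow> (\<forall>j<k. \<exists>y>0. rec_eval r (j # xs) y) \<Longrightarrow> rec_eval (Minim r) xs k"

definition int_vecs :: "nat \<Rightarrow> int list set" where
  "int_vecs n = {x. length x = n}"

text \<open>
  A function from \<open>\<int>\<^sup>k\<close> to \<open>\<int>\<^sup>n\<close> is computable if each of its coordinates is a recursive function,
  where integers are coded as natural numbers by the bijection \<^const>\<open>int_encode\<close>.
\<close>

definition computable_int_fun :: "nat \<Rightarrow> nat \<Rightarrow> (int list \<Rightarrow> int list) \<Rightarrow> bool" where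
  "computable_int_fun k n h \<longleftrightarrow>
     (\<forall>j<n. \<exists>r. \<forall>x\<in>int_vecs k. \<forall>y.
        rec_eval r (map int_encode x) y \<longleftrightarrow> y = int_encode (h x ! j))"


section \<open>Programs and computations\<close>

record 'a program =
  states :: "'a set"
  inits :: "'a set"
  trans_rel :: "'a \<Rightarrow> 'a \<Rightarrow> bool"

datatype 'a seqn = FinSeq "'a list" | InfSeq "nat \<Rightarrow> 'a"

fun computation :: "'a program \<Rightarrow> 'a seqn \<Rightarrow> bool" where
  "computation P (FinSeq xs) \<longleftrightarrow>
     xs \<noteq> [] \<and> set xs \<subseteq> states P \<and> hd xs \<in> inits P \<and>
     (\<forall>i. Suc i < length xs \<longrightarrow> trans_rel P (xs ! i) (xs ! Suc i)) \<and>
     \<not> (\<exists>t\<in>states P. trans_rel P (last xs) t)"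
| "computation P (InfSeq s) \<longleftrightarrow>
     range s \<subseteq> states P \<and> s 0 \<in> inits P \<and> (\<forall>i. trans_rel P (s i) (s (Suc i)))"

definition terminates :: "'a program \<Rightarrow> bool" where
  "terminates P \<longleftrightarrow> (\<forall>c. computation P c \<longrightarrow> (\<exists>xs. c = FinSeq xs))"

definition loop_condition :: "int list \<Rightarrow> bool" where
  "loop_condition x \<longleftrightarrow> (\<forall>j<length x. x ! j > 0)"

text \<open>The argument \<open>(X, u)\<close> of the updates, an element of \<open>\<int>\<^sup>n\<^sup>+\<^sup>1\<close>, is the list \<open>X @ [u]\<close>.\<close>

definition while_program ::
    "nat \<Rightarrow> nat \<Rightarrow> (nat \<Rightarrow> int list \<Rightarrow> int list) \<Rightarrow> int list program" where
  "while_program n m g =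
     \<lparr> states = int_vecs n,
       inits = int_vecs n,
       trans_rel = (\<lambda>s t. s \<in> int_vecs n \<and> loop_condition s \<and>
                          (\<exists>i\<in>{1..m}. \<exists>u. t = g i (s @ [u]))) \<rparr>"


section \<open>Min-plus matrices\<close>

text \<open>
  An \<open>M \<times> M\<close> matrix is a function of two indices, of which only the values on \<open>{1..M}\<close> matter.
  The library type \<^typ>\<open>int extended\<close> also contains \<open>-\<infinity>\<close>; the predicate \<open>associated_matrix\<close>
  below excludes it as an entry, and min-plus products do not introduce it.
\<close>

type_synonym ext_matrix = "nat \<Rightarrow> nat \<Rightarrow> int extended"

definition minplus_mult :: "nat \<Rightarrow> ext_matrix \<Rightarrow> ext_matrix \<Rightarrow> ext_matrix" where
  "minplus_mult M A B = (\<lambda>i j. Min ((\<lambda>k. A i k + B k j) ` {1..M}))"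

text \<open>Only products of nonempty lists are meaningful.\<close>

fun minplus_prod :: "nat \<Rightarrow> ext_matrix list \<Rightarrow> ext_matrix" where
  "minplus_prod M [] = undefined"
| "minplus_prod M [A] = A"
| "minplus_prod M (A # B # As) = minplus_mult M A (minplus_prod M (B # As))"

text \<open>
  An entry may be \<open>\<infinity>\<close> even if the difference happens to be constant, since it records only what is
  known.
\<close>

definition associated_matrix ::
    "nat \<Rightarrow> nat \<Rightarrow> (nat \<Rightarrow> int list \<Rightarrow> nat) \<Rightarrow> (int list \<Rightarrow> int list) \<Rightarrow> ext_matrix \<Rightarrow> bool" where
  "associated_matrix n M f h A \<longleftrightarrow>
     (\<forall>i\<in>{1..M}. \<forall>j\<in>{1..M}.
        A i j = Pinf \<or>
        (\<exists>d. A i j = Fin d \<and>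
             (\<forall>X\<in>int_vecs n. loop_condition X \<longrightarrow>
                (\<forall>u. int (f j (h (X @ [u]))) = int (f i X) + d))))"

end

theory Submission
  imports Defs "HOL-Library.Ramsey"
begin

text \<open>
  A finite entry \<open>(i, j)\<close> of the product of the matrices along a segment of a run is the exact change
  from \<open>f\<^sub>i\<close> at its start to \<open>f\<^sub>j\<close> at its end, because it is attained along some path of finite
  entries. So along an infinite run, any two times \<open>a < b\<close> have an index \<open>i \<le> M\<close> at which \<open>f\<^sub>i\<close>
  strictly decreases from \<open>a\<close> to \<open>b\<close>. Hence the transitive relation \<open>a < b\<close>, read backwards, is a
  finite union of well-founded relations, and by Ramsey's theorem (Podelski--Rybalchenko) it is
  itself well-founded, which is absurd.
\<close>

lemma extended_add_eq_Fin:
  assumes "x + y = Fin d"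
  obtains a b where "x = Fin a" "y = Fin b" "d = a + b"
  using assms by (cases x; cases y) auto

text \<open>The minimum over a nonempty finite index set is attained, and a sum in
  \<open>int extended\<close> is finite only if both summands are.\<close>

lemma minplus_mult_FinE:
  assumes "minplus_mult M A B i j = Fin d" and "M \<ge> 1"
  obtains k a b where "k \<in> {1..M}" "A i k = Fin a" "B k j = Fin b" "d = a + b"
proof -
  have "Min ((\<lambda>k. A i k + B k j) ` {1..M}) \<in> (\<lambda>k. A i k + B k j) ` {1..M}"
    using assms(2) by (intro Min_in) auto
  then obtain k where "k \<in> {1..M}" "A i k + B k j = Fin d"
    using assms(1) by (auto simp: minplus_mult_def)
  then show thesis
    by (meson extended_add_eq_Fin that)
qed

text \<open>Induction with \<open>b\<close> fixed and the first matrix split off: the changes along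
  the first step and the rest telescope through \<open>v k (Suc a)\<close> for the index
  \<open>k\<close> attaining the minimum.\<close>

lemma minplus_prod_upt_Fin:
  fixes D :: "nat \<Rightarrow> ext_matrix" and v :: "nat \<Rightarrow> nat \<Rightarrow> int"
  assumes step: "\<And>k i j d. i \<in> {1..M} \<Longrightarrow> j \<in> {1..M} \<Longrightarrow> D k i j = Fin d \<Longrightarrow>
      v j (Suc k) = v i k + d"
    and "a < b" "i \<in> {1..M}" "j \<in> {1..M}" "minplus_prod M (map D [a..<b]) i j = Fin d"
  shows "v j b = v i a + d"
  using assms(2-)
proof (induction "b - a" arbitrary: a i d)
  case 0
  then show ?case by simp
next
  case (Suc l)
  show ?case
  proof (cases "Suc a = b")
    case True
    then show ?thesis
      using Suc.prems step by auto
  next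
    case False
    then have "Suc a < b" using Suc.prems by simp
    \<comment> \<open>The recursion of \<open>minplus_prod\<close> matches two leading elements, so
      both must be exposed.\<close>
    then have "[a..<b] = a # Suc a # [Suc (Suc a)..<b]" "[Suc a..<b] = Suc a # [Suc (Suc a)..<b]"
      by (simp_all add: upt_conv_Cons)
    then have "minplus_mult M (D a) (minplus_prod M (map D [Suc a..<b])) i j = Fin d"
      using Suc.prems by simp
    then obtain k x y where k: "k \<in> {1..M}" "D a i k = Fin x"
        "minplus_prod M (map D [Suc a..<b]) k j = Fin y" "d = x + y"
      using Suc.prems by (auto elim: minplus_mult_FinE)
    have "v j b = v k (Suc a) + y"
      using Suc.hyps(1)[of "Suc a"] Suc.hyps(2) \<open>Suc a < b\<close> k Suc.prems by simp
    then show ?thesis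
      using step[of i k a x] k Suc.prems by simp
  qed
qed

text \<open>The index \<open>i\<close> may vary with the pair, so no single \<open>v i\<close> need
  descend along all times; Ramsey's theorem supplies an infinite set of times sharing one
  index.\<close>

lemma no_finite_family_decreasing_between_all_times:
  fixes v :: "nat \<Rightarrow> nat \<Rightarrow> nat"
  assumes "\<And>a b. a < b \<Longrightarrow> \<exists>i\<in>{1..M}. v i b < v i a"
  shows False
proof -
  define T where "T i = {(b, a). a < b \<and> v i b < v i a}" for i
  define r where "r = {(b, a :: nat). a < b}"
  have "wf (T i)" for i
    by (rule wf_subset[OF wf_measure[of "v i"]]) (auto simp: T_def)
  \<comment> \<open>\<open>disj_wf\<close> indexes from 0; the extra \<open>T 0\<close> is also
    well-founded and contained in \<open>r\<close>.\<close>
  moreover have "r = (\<Union>i<Suc M. T i)"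
    using assms by (fastforce simp: r_def T_def)
  ultimately have "disj_wf r"
    unfolding disj_wf_def by blast
  moreover have "trans r"
    by (auto simp: r_def trans_def)
  ultimately have "wf r"
    by (rule trans_disj_wf_implies_wf[rotated])
  moreover have "\<forall>k. (Suc k, k) \<in> r"
    by (simp add: r_def)
  ultimately show False
    using wf_iff_no_infinite_down_chain[of r] by (meson exI[of "\<lambda>f. \<forall>k. (f (Suc k), f k) \<in> r" "\<lambda>k. k"])
qed

theorem theorem8p6:
  fixes n m M :: nat
    and g :: "nat \<Rightarrow> int list \<Rightarrow> int list"
    and f :: "nat \<Rightarrow> int list \<Rightarrow> nat"
    and C :: "nat \<Rightarrow> ext_matrix"
  assumes "n \<ge> 1" and "m \<ge> 1"
    and "\<forall>l\<in>{1..m}. g l \<in> int_vecs (n + 1) \<rightarrow> int_vecs n"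
    and "\<forall>l\<in>{1..m}. computable_int_fun (n + 1) n (g l)"
    and "\<forall>l\<in>{1..m}. associated_matrix n M f (g l) (C l)"
    and "\<forall>ls. ls \<noteq> [] \<and> set ls \<subseteq> {1..m} \<longrightarrow>
           (\<exists>i\<in>{1..M}. \<exists>d<0. minplus_prod M (map C ls) i i = Fin d)"
  shows "terminates (while_program n m g)"
proof -
  have False if "computation (while_program n m g) (InfSeq s)" for s
  proof -
    have s: "s k \<in> int_vecs n" "loop_condition (s k)"
      and "\<exists>l\<in>{1..m}. \<exists>u. s (Suc k) = g l (s k @ [u])" for k
      using that by (auto simp: while_program_def)
    then obtain c u where c: "\<And>k. c k \<in> {1..m}" "\<And>k. s (Suc k) = g (c k) (s k @ [u k])"
      by metis
    have step: "int (f j (s (Suc k))) = int (f i (s k)) + d"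
      if "i \<in> {1..M}" "j \<in> {1..M}" "C (c k) i j = Fin d" for i j k d
    proof -
      have "associated_matrix n M f (g (c k)) (C (c k))"
        using assms(5) c(1) by blast
      then show ?thesis
        using that s[of k] unfolding associated_matrix_def c(2) by fastforce
    qed
    have "\<exists>i\<in>{1..M}. f i (s b) < f i (s a)" if "a < b" for a b
    proof -
      \<comment> \<open>The product to inspect is that of the controls chosen at times
        \<open>a\<close> to \<open>b - 1\<close>.\<close>
      have "map c [a..<b] \<noteq> []" "set (map c [a..<b]) \<subseteq> {1..m}"
        using that c(1) by auto
      then obtain i d where i: "i \<in> {1..M}" "d < 0"
          "minplus_prod M (map C (map c [a..<b])) i i = Fin d"
        using assms(6) by blast
      have "minplus_prod M (map (\<lambda>k. C (c k)) [a..<b]) i i = Fin d"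
        using i(3) by (simp add: comp_def)
      then have "int (f i (s b)) = int (f i (s a)) + d"
        using minplus_prod_upt_Fin[of M "\<lambda>k. C (c k)" "\<lambda>i k. int (f i (s k))"] step that i(1)
        by blast
      then show ?thesis
        \<comment> \<open>Being diagonal, the entry compares \<open>f i\<close> with itself, and
          \<open>d < 0\<close> makes it drop.\<close>
        using i by (intro bexI[of _ i]) auto
    qed
    then show False
      by (rule no_finite_family_decreasing_between_all_times)
  qed
  then show ?thesis
    unfolding terminates_def by (metis seqn.exhaust)
qed

end
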